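(* Let $A$ and $B$ be proper subgroups of a finite group $G$. Consider the right coset action of $G$ on $\Omega_B=\{Bg : g\in G\}$, and set $\beta:=B\in\Omega_B$. Then $\mathcal{T}=(G,A,B)$ is a triple factorisation if and only if the $A$-orbit $\beta^A$ has restricted movement.
   Context: $(G,A,B)$ is a triple factorisation if $G=ABA$. The right coset action of $G$ on $\Omega_B$ is by right multiplication. For a finite subset $\Gamma$ of a set $\Omega$ on which $G$ acts, the movement is $\mathrm{move}(\Gamma)=\max_{g\in G}|\Gamma^g\setminus\Gamma|$, and $\Gamma$ has restricted movement if $\mathrm{move}(\Gamma)<|\Gamma|$, that is, $\Gamma^g\cap\Gamma\neq\emptyset$ for all $g\in G$. *)

theory Defs
  imports "HOL-Algebra.Group_Action"
begin

definition triple_factorisation :: "('a, 'm) monoid_scheme \<Rightarrow> 'a set \<Rightarrow> 'a set \<Rightarrow> bool" where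
  "triple_factorisation G A B \<longleftrightarrow> carrier G = A <#>\<^bsub>G\<^esub> B <#>\<^bsub>G\<^esub> A"

text \<open>
  The library's \<^locale>\<open>group_action\<close> is about left actions. A right action is given here
  by a map \<open>\<phi>\<close> with \<open>\<phi> g x\<close> in the role of \<open>x\<^sup>g\<close>. The library's
  \<^const>\<open>orbit\<close> depends only on \<open>\<phi>\<close> as a function and applies to right actions unchanged.
\<close>

locale right_group_action = group G for G (structure) +
  fixes \<Omega> :: "'b set" and \<phi> :: "'a \<Rightarrow> 'b \<Rightarrow> 'b"
  assumes act_closed: "\<lbrakk>g \<in> carrier G; x \<in> \<Omega>\<rbrakk> \<Longrightarrow> \<phi> g x \<in> \<Omega>"
    and act_one: "x \<in> \<Omega> \<Longrightarrow> \<phi> \<one> x = x"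
    and act_mult: "\<lbrakk>g \<in> carrier G; h \<in> carrier G; x \<in> \<Omega>\<rbrakk> \<Longrightarrow> \<phi> (g \<otimes> h) x = \<phi> h (\<phi> g x)"

definition right_coset_action ::
    "('a, 'm) monoid_scheme \<Rightarrow> 'a set \<Rightarrow> 'a \<Rightarrow> 'a set \<Rightarrow> 'a set" where
  "right_coset_action G B g = (\<lambda>x \<in> rcosets\<^bsub>G\<^esub> B. x #>\<^bsub>G\<^esub> g)"

text \<open>
  For finite \<open>\<Gamma>\<close> the maximum is over a nonempty set of numbers bounded by \<open>card \<Gamma>\<close>, hence it is
  meaningful even if the group is infinite.
\<close>

definition movement ::
    "('a, 'm) monoid_scheme \<Rightarrow> ('a \<Rightarrow> 'b \<Rightarrow> 'b) \<Rightarrow> 'b set \<Rightarrow> nat" where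
  "movement G \<phi> \<Gamma> = Max {card (\<phi> g ` \<Gamma> - \<Gamma>) | g. g \<in> carrier G}"

definition restricted_movement ::
    "('a, 'm) monoid_scheme \<Rightarrow> ('a \<Rightarrow> 'b \<Rightarrow> 'b) \<Rightarrow> 'b set \<Rightarrow> bool" where
  "restricted_movement G \<phi> \<Gamma> \<longleftrightarrow> finite \<Gamma> \<and> movement G \<phi> \<Gamma> < card \<Gamma>"

lemma (in group) right_coset_action_is_action:
  assumes "subgroup B G"
  shows "right_group_action G (rcosets B) (right_coset_action G B)"
proof
  have B: "B \<subseteq> carrier G" using assms by (rule subgroup.subset)
  fix x assume x: "x \<in> rcosets B"
  then obtain a where a: "a \<in> carrier G" "x = B #> a" by (auto simp: RCOSETS_def)
  show "right_coset_action G B \<one> x = x"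
    using x a B by (simp add: right_coset_action_def coset_mult_assoc)
  fix g assume g: "g \<in> carrier G"
  have cl: "y \<in> carrier G \<Longrightarrow> x #> y \<in> rcosets B" for y
    using a B by (simp add: coset_mult_assoc rcosetsI)
  show "right_coset_action G B g x \<in> rcosets B"
    using x g cl by (simp add: right_coset_action_def)
  fix h assume h: "h \<in> carrier G"
  show "right_coset_action G B (g \<otimes> h) x = right_coset_action G B h (right_coset_action G B g x)"
    using x a g h B cl by (simp add: right_coset_action_def coset_mult_assoc m_assoc)
qed

end

theory Submission
  imports Defs
begin

text \<open>
  Let \<open>\<Gamma> = {Ba | a \<in> A}\<close> be the orbit of the coset \<open>B\<close> under \<open>A\<close>. Since each \<open>g\<close> permutes the
  cosets, \<open>\<Gamma>\<^sup>g\<close> has as many points as \<open>\<Gamma>\<close>, so it moves fewer than \<open>|\<Gamma>|\<close> points out of \<open>\<Gamma>\<close>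
  exactly when it meets \<open>\<Gamma>\<close>; restricted movement says that this happens for every \<open>g\<close>
  (\<open>restricted_movement_iff_meets_translates\<close>). A common point of \<open>\<Gamma>\<^sup>g\<close> and \<open>\<Gamma>\<close> is an equation
  \<open>Bag = Ba'\<close> with \<open>a, a' \<in> A\<close>, that is, \<open>g \<in> a\<inverse>Ba'\<close>. Hence \<open>\<Gamma>\<^sup>g\<close> meets \<open>\<Gamma>\<close> if and only if
  \<open>g \<in> ABA\<close> (\<open>coset_orbit_meets_translate_iff\<close>), and this holds for every \<open>g\<close> if and only if
  \<open>G = ABA\<close>.
\<close>

context right_group_action
begin

lemma inj_on_act:
  assumes g: "g \<in> carrier G"
  shows "inj_on (\<phi> g) \<Omega>"
proof (rule inj_on_inverseI)
  fix x assume "x \<in> \<Omega>"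
  then show "\<phi> (inv g) (\<phi> g x) = x"
    using act_mult[of g "inv g" x] act_one[of x] g by simp
qed

text \<open>
  A translate has the same size as the set, so the movement reaches its upper bound \<open>card \<Gamma>\<close>
  precisely when some translate is disjoint from \<open>\<Gamma>\<close>.
\<close>

lemma restricted_movement_iff_meets_translates:
  assumes fin: "finite \<Gamma>" and sub: "\<Gamma> \<subseteq> \<Omega>"
  shows "restricted_movement G \<phi> \<Gamma> \<longleftrightarrow> (\<forall>g\<in>carrier G. \<phi> g ` \<Gamma> \<inter> \<Gamma> \<noteq> {})"
proof -
  have card_less: "card (\<phi> g ` \<Gamma> - \<Gamma>) < card \<Gamma> \<longleftrightarrow> \<phi> g ` \<Gamma> \<inter> \<Gamma> \<noteq> {}"
    if g: "g \<in> carrier G" for g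
  proof -
    have "card (\<phi> g ` \<Gamma>) = card \<Gamma>"
      using inj_on_subset[OF inj_on_act[OF g] sub] by (rule card_image)
    moreover have "card (\<phi> g ` \<Gamma> - \<Gamma>) + card (\<phi> g ` \<Gamma> \<inter> \<Gamma>) = card (\<phi> g ` \<Gamma>)"
      using fin card_Int_Diff[of "\<phi> g ` \<Gamma>" \<Gamma>] by simp
    moreover have "card (\<phi> g ` \<Gamma> \<inter> \<Gamma>) = 0 \<longleftrightarrow> \<phi> g ` \<Gamma> \<inter> \<Gamma> = {}"
      using fin by simp
    ultimately show ?thesis by linarith
  qed
  let ?M = "{card (\<phi> g ` \<Gamma> - \<Gamma>) | g. g \<in> carrier G}"
  have "card (\<phi> g ` \<Gamma> - \<Gamma>) \<le> card \<Gamma>" for g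
    using card_mono[of "\<phi> g ` \<Gamma>" "\<phi> g ` \<Gamma> - \<Gamma>"] card_image_le[OF fin, of "\<phi> g"] fin by simp
  then have "?M \<subseteq> {..card \<Gamma>}" by auto
  then have "finite ?M" by (rule finite_subset) simp
  moreover have "?M \<noteq> {}" using one_closed by blast
  ultimately have "movement G \<phi> \<Gamma> < card \<Gamma> \<longleftrightarrow> (\<forall>m\<in>?M. m < card \<Gamma>)"
    unfolding movement_def by (rule Max_less_iff)
  then show ?thesis
    using fin card_less by (auto simp: restricted_movement_def)
qed

end

context group
begin

lemma orbit_right_coset_action:
  assumes B: "subgroup B G"
  shows "orbit (G\<lparr>carrier := A\<rparr>) (right_coset_action G B) B = (\<lambda>a. B #> a) ` A"
proof -
  have "B \<in> rcosets B"
    using subgroup.subgroup_in_rcosets[OF B is_group] .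
  then show ?thesis
    by (auto simp: orbit_def right_coset_action_def)
qed

text \<open>
  The inverse of the first factor is absorbed because \<open>A\<close> is closed under inverses: as \<open>a\<close> runs
  over \<open>A\<close>, so does \<open>a\<inverse>\<close>.
\<close>

lemma coset_orbit_meets_translate_iff:
  assumes A: "subgroup A G" and B: "subgroup B G" and g: "g \<in> carrier G"
  shows "(\<lambda>a. B #> a #> g) ` A \<inter> (\<lambda>a. B #> a) ` A \<noteq> {} \<longleftrightarrow> g \<in> A <#> B <#> A"
proof -
  interpret A: subgroup A G by (rule A)
  interpret B: subgroup B G by (rule B)
  have same_coset: "B #> a #> g = B #> a' \<longleftrightarrow> (\<exists>b\<in>B. a \<otimes> g = b \<otimes> a')"
    if a: "a \<in> A" and a': "a' \<in> A" for a a'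
  proof -
    have "B #> a #> g = B #> (a \<otimes> g)"
      using a g by (simp add: coset_mult_assoc B.subset)
    moreover have "B #> (a \<otimes> g) = B #> a' \<longleftrightarrow> a \<otimes> g \<in> B #> a'"
      using a a' g B repr_independence[of "a \<otimes> g" B a'] rcos_self[of "a \<otimes> g" B] by auto
    ultimately show ?thesis by (auto simp: r_coset_def)
  qed
  have solve: "a \<otimes> g = b \<otimes> a' \<longleftrightarrow> g = inv a \<otimes> b \<otimes> a'"
    if "a \<in> A" "b \<in> B" "a' \<in> A" for a b a'
  proof -
    have "a \<in> carrier G" "b \<in> carrier G" "a' \<in> carrier G" using that by auto
    then show ?thesis
      using g inv_solve_left[of g a "b \<otimes> a'"] by (simp add: m_assoc eq_commute)
  qed
  have "(\<lambda>a. B #> a #> g) ` A \<inter> (\<lambda>a. B #> a) ` A \<noteq> {} \<longleftrightarrow>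
      (\<exists>a\<in>A. \<exists>a'\<in>A. B #> a #> g = B #> a')"
    by blast
  also have "\<dots> \<longleftrightarrow> (\<exists>a\<in>A. \<exists>a'\<in>A. \<exists>b\<in>B. g = inv a \<otimes> b \<otimes> a')"
    using same_coset solve by simp
  also have "\<dots> \<longleftrightarrow> (\<exists>a\<in>A. \<exists>a'\<in>A. \<exists>b\<in>B. g = a \<otimes> b \<otimes> a')"
    by (metis A.m_inv_closed A.mem_carrier inv_inv)
  also have "\<dots> \<longleftrightarrow> g \<in> A <#> B <#> A"
    by (auto simp: set_mult_def)
  finally show ?thesis .
qed

end

theorem proposition3p2:
  fixes G :: "('a, 'm) monoid_scheme" and A B :: "'a set"
  assumes "group G" and "finite (carrier G)"
    and "subgroup A G" and "A \<noteq> carrier G"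
    and "subgroup B G" and "B \<noteq> carrier G"
  shows "triple_factorisation G A B \<longleftrightarrow>
    restricted_movement G (right_coset_action G B)
      (orbit (G\<lparr>carrier := A\<rparr>) (right_coset_action G B) B)"
proof -
  interpret group G by fact
  interpret right_group_action G "rcosets\<^bsub>G\<^esub> B" "right_coset_action G B"
    using \<open>subgroup B G\<close> by (rule right_coset_action_is_action)
  have A: "A \<subseteq> carrier G" and B: "B \<subseteq> carrier G"
    using \<open>subgroup A G\<close> \<open>subgroup B G\<close> by (auto dest: subgroup.subset)
  let ?\<Gamma> = "(\<lambda>a. B #>\<^bsub>G\<^esub> a) ` A"
  have \<Gamma>: "?\<Gamma> \<subseteq> rcosets\<^bsub>G\<^esub> B"
    using A B by (auto intro: rcosetsI)
  have "finite ?\<Gamma>"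
    using finite_subset[OF A \<open>finite (carrier G)\<close>] by simp
  then have "restricted_movement G (right_coset_action G B) ?\<Gamma> \<longleftrightarrow>
      (\<forall>g\<in>carrier G. right_coset_action G B g ` ?\<Gamma> \<inter> ?\<Gamma> \<noteq> {})"
    using \<Gamma> by (rule restricted_movement_iff_meets_translates)
  also have "\<dots> \<longleftrightarrow> (\<forall>g\<in>carrier G. g \<in> A <#>\<^bsub>G\<^esub> B <#>\<^bsub>G\<^esub> A)"
  proof (rule ball_cong[OF refl])
    fix g assume g: "g \<in> carrier G"
    have "right_coset_action G B g ` ?\<Gamma> = (\<lambda>a. B #>\<^bsub>G\<^esub> a #>\<^bsub>G\<^esub> g) ` A"
      unfolding image_image
      by (rule image_cong) (use \<Gamma> in \<open>auto simp: right_coset_action_def\<close>)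
    then show "right_coset_action G B g ` ?\<Gamma> \<inter> ?\<Gamma> \<noteq> {} \<longleftrightarrow> g \<in> A <#>\<^bsub>G\<^esub> B <#>\<^bsub>G\<^esub> A"
      using coset_orbit_meets_translate_iff[OF \<open>subgroup A G\<close> \<open>subgroup B G\<close> g] by simp
  qed
  also have "\<dots> \<longleftrightarrow> triple_factorisation G A B"
    using set_mult_closed[OF set_mult_closed[OF A B] A]
    by (auto simp: triple_factorisation_def)
  finally show ?thesis
    using orbit_right_coset_action[OF \<open>subgroup B G\<close>] by simp
qed

end
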